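(* (Wiener-Khinchin Theorem for Non-WSS Processes) Let $x(t)$, $t\in\mathbb{R}$, be a real-valued random process with autocorrelation $R_x(t_1,t_2)=E[x(t_1)x(t_2)]$. Assume that (i) $\displaystyle \int_{-T}^{T}\int_{-T}^{T} E[|x(t_1)x(t_2)|]\,dt_1\,dt_2<\infty$ for any finite $T$; (ii) the function $R_x^m(\tau)=\sup_{t}|R_x(t,t-\tau)|$ is integrable. Then $$S_x(\omega)=\int_{-\infty}^{\infty}\bar{R}_x(\tau)\,e^{-j\omega\tau}\,d\tau,$$ i.e. the power spectral density $$S_x(\omega)=\lim_{T\to\infty}\frac{E[|X_T(\omega)|^2]}{2T},\qquad X_T(\omega)=\int_{-T}^{T}x(t)e^{-j\omega t}\,dt,$$ is equal to the Fourier transform of the averaged autocorrelation function $$\bar{R}_x(\tau)=\lim_{T\to\infty}\frac{1}{2T}\int_{-T}^{T}R_x(t,t-\tau)\,dt .$$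
   Context: Here $j=\sqrt{-1}$ and $E[\cdot]$ denotes expectation with respect to the law of the process $x(t)$. The process is not assumed to be wide sense stationary (WSS). The function $R_x^m$ is called the maximum absolute autocorrelation function of $x$, and $\bar{R}_x$ its averaged autocorrelation function.
   Formalization: The process is taken jointly measurable, and the limit defining the averaged autocorrelation is assumed to exist for almost every τ, since (i) and (ii) do not imply it (slow oscillating modulation is a counterexample); existence of the limit S_x(ω) is proved for every ω. *)

theory Defs
  imports "HOL-Probability.Probability"
begin

definition autocorrelation :: "'a measure \<Rightarrow> (real \<Rightarrow> 'a \<Rightarrow> real) \<Rightarrow> real \<Rightarrow> real \<Rightarrow> real" where
  "autocorrelation M x t1 t2 = (LINT u|M. x t1 u * x t2 u)"

(* Valued in [0,\<infinity>], since the supremum may be infinite for some values of \<tau>. *)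
definition max_abs_autocorrelation :: "'a measure \<Rightarrow> (real \<Rightarrow> 'a \<Rightarrow> real) \<Rightarrow> real \<Rightarrow> ennreal" where
  "max_abs_autocorrelation M x \<tau> = (SUP t. ennreal \<bar>autocorrelation M x t (t - \<tau>)\<bar>)"

definition time_average_autocorrelation ::
    "'a measure \<Rightarrow> (real \<Rightarrow> 'a \<Rightarrow> real) \<Rightarrow> real \<Rightarrow> real \<Rightarrow> real" where
  "time_average_autocorrelation M x T \<tau> =
     1 / (2 * T) * (LINT t:{-T..T}|lebesgue. autocorrelation M x t (t - \<tau>))"

definition averaged_autocorrelation :: "'a measure \<Rightarrow> (real \<Rightarrow> 'a \<Rightarrow> real) \<Rightarrow> real \<Rightarrow> real" where
  "averaged_autocorrelation M x \<tau> = Lim at_top (\<lambda>T. time_average_autocorrelation M x T \<tau>)"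

definition truncated_fourier :: "(real \<Rightarrow> 'a \<Rightarrow> real) \<Rightarrow> real \<Rightarrow> real \<Rightarrow> 'a \<Rightarrow> complex" where
  "truncated_fourier x T \<omega> u =
     (LINT t:{-T..T}|lebesgue. complex_of_real (x t u) * exp (- \<i> * complex_of_real (\<omega> * t)))"

definition mean_periodogram :: "'a measure \<Rightarrow> (real \<Rightarrow> 'a \<Rightarrow> real) \<Rightarrow> real \<Rightarrow> real \<Rightarrow> real" where
  "mean_periodogram M x T \<omega> = (LINT u|M. (cmod (truncated_fourier x T \<omega> u))\<^sup>2) / (2 * T)"

definition power_spectral_density :: "'a measure \<Rightarrow> (real \<Rightarrow> 'a \<Rightarrow> real) \<Rightarrow> real \<Rightarrow> real" where
  "power_spectral_density M x \<omega> = Lim at_top (\<lambda>T. mean_periodogram M x T \<omega>)"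

definition fourier_transform :: "(real \<Rightarrow> real) \<Rightarrow> real \<Rightarrow> complex" where
  "fourier_transform f \<omega> =
     (LINT \<tau>|lebesgue. complex_of_real (f \<tau>) * exp (- \<i> * complex_of_real (\<omega> * \<tau>)))"

end

theory Submission
  imports Defs
begin

text \<open>
  By Fubini, the mean of \<open>\<bar>X\<^sub>T(\<omega>)\<bar>\<^sup>2\<close> is the double integral of
  \<open>R(t\<^sub>1, t\<^sub>2) exp (- \<i> \<omega> (t\<^sub>1 - t\<^sub>2))\<close> over the square \<open>[-T, T]\<^sup>2\<close>
  (\<open>second_moment_weighted_integral\<close>). The exponential depends on the lag \<open>\<tau> = t\<^sub>1 - t\<^sub>2\<close>
  only, so in the coordinates \<open>(t, \<tau>)\<close> of \<open>integral_lag_coordinates\<close> the mean periodogram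
  becomes exactly, for each \<open>T\<close>, the Fourier transform of a function \<open>g\<^sub>T\<close>: the integral of
  \<open>R(t, t - \<tau>)\<close> over those \<open>t\<close> for which both \<open>t\<close> and \<open>t - \<tau>\<close> lie in the window,
  divided by \<open>2T\<close> (\<open>mean_periodogram_eq_windowed\<close>).

  It remains to pass to the limit under the Fourier integral. The function \<open>g\<^sub>T\<close> differs from
  the plain time average only by the times \<open>t\<close> whose partner \<open>t - \<tau>\<close> leaves the window. They
  fill at most length \<open>\<bar>\<tau>\<bar>\<close>, so the difference is at most
  \<open>R\<^sup>m(\<tau>) \<bar>\<tau>\<bar> / (2T)\<close> and vanishes as \<open>T\<close> grows, whenever \<open>R\<^sup>m(\<tau>)\<close> is finite
  (\<open>abs_windowed_minus_time_average_le\<close>). Hence \<open>g\<^sub>T\<close> converges almost everywhere to the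
  averaged autocorrelation. Since also \<open>\<bar>g\<^sub>T\<bar> \<le> R\<^sup>m\<close>
  (\<open>abs_windowed_autocorrelation_le\<close>) and \<open>R\<^sup>m\<close> is integrable, dominated convergence
  gives the theorem.
\<close>

section \<open>Second moments of weighted time integrals\<close>

lemma borel_measurable_autocorrelation:
  assumes "prob_space M"
    and process: "(\<lambda>(t, u). x t u) \<in> borel_measurable (borel \<Otimes>\<^sub>M M)"
  shows "(\<lambda>p. autocorrelation M x (fst p) (snd p)) \<in> borel_measurable (lborel \<Otimes>\<^sub>M lborel)"
proof -
  interpret prob_space M by fact
  have [measurable]: "(\<lambda>p. x (f p) (g p)) \<in> borel_measurable N"
    if "f \<in> borel_measurable N" "g \<in> measurable N M" for f g and N :: "((real \<times> real) \<times> 'a) measure"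
    using measurable_compose[OF measurable_Pair[OF that] process] by simp
  have "case_prod (\<lambda>p u. x (fst p) u * x (snd p) u) \<in>
      borel_measurable ((lborel \<Otimes>\<^sub>M lborel) \<Otimes>\<^sub>M M)"
    unfolding split_beta by measurable
  from borel_measurable_lebesgue_integral[OF this]
  show ?thesis
    unfolding autocorrelation_def by simp
qed

text \<open>
  The squared modulus of a path integral is an iterated integral of the product of the path with its
  conjugate. Absolute integrability of this product over both times and the sample space lets the
  expectation move inside, where it turns the product of samples into the autocorrelation. With
  \<open>w\<close> the complex exponential cut off outside \<open>[-T, T]\<close> the path integral is the truncated
  Fourier transform.
\<close>

lemma second_moment_weighted_integral:
  fixes w :: "real \<Rightarrow> complex"
  assumes "prob_space M"
    and process: "(\<lambda>(t, u). x t u) \<in> borel_measurable (borel \<Otimes>\<^sub>M M)"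
    and w[measurable]: "w \<in> borel_measurable borel"
    and fin: "(\<integral>\<^sup>+t1. \<integral>\<^sup>+t2. \<integral>\<^sup>+u. ennreal (cmod (w t1) * cmod (w t2) * \<bar>x t1 u * x t2 u\<bar>)
       \<partial>M \<partial>lborel \<partial>lborel) < \<infinity>"
  defines "G \<equiv> \<lambda>p. w (fst p) * cnj (w (snd p)) * autocorrelation M x (fst p) (snd p)"
  shows "integrable (lborel \<Otimes>\<^sub>M lborel) G"
    and "complex_of_real (LINT u|M. (cmod (LINT t|lborel. w t * x t u))\<^sup>2) =
      (LINT p|(lborel \<Otimes>\<^sub>M lborel). G p)"
proof -
  interpret prob_space M by fact
  let ?L = "lborel \<Otimes>\<^sub>M lborel :: (real \<times> real) measure"
  interpret P: pair_sigma_finite ?L M ..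
  have x_meas: "(\<lambda>q. x (f q) (snd q)) \<in> borel_measurable (?L \<Otimes>\<^sub>M M)"
    if "f \<in> borel_measurable (?L \<Otimes>\<^sub>M M)" for f
    using measurable_compose[OF measurable_Pair[OF that measurable_snd] process] by simp
  have [measurable]: "(\<lambda>q. x (fst (fst q)) (snd q)) \<in> borel_measurable (?L \<Otimes>\<^sub>M M)"
    "(\<lambda>q. x (snd (fst q)) (snd q)) \<in> borel_measurable (?L \<Otimes>\<^sub>M M)"
    by (rule x_meas, simp)+
  have [measurable]: "cnj \<in> borel_measurable borel"
    by (intro borel_measurable_continuous_onI continuous_intros)
  define F where "F p u = w (fst p) * cnj (w (snd p)) * complex_of_real (x (fst p) u * x (snd p) u)"
    for p u
  have F_meas[measurable]: "case_prod F \<in> borel_measurable (?L \<Otimes>\<^sub>M M)"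
    unfolding F_def split_beta by measurable
  have F_norm: "norm (F p u) = cmod (w (fst p)) * cmod (w (snd p)) * \<bar>x (fst p) u * x (snd p) u\<bar>" for p u
    by (simp add: F_def norm_mult abs_mult)
  have nn: "(\<lambda>q. ennreal (norm (case_prod F q))) \<in> borel_measurable (?L \<Otimes>\<^sub>M M)"
    by measurable
  have nn': "(\<lambda>p. \<integral>\<^sup>+u. ennreal (norm (F p u)) \<partial>M) \<in> borel_measurable ?L"
    using borel_measurable_nn_integral_fst[OF nn] by simp
  have "(\<integral>\<^sup>+q. ennreal (norm (case_prod F q)) \<partial>(?L \<Otimes>\<^sub>M M)) =
      (\<integral>\<^sup>+p. \<integral>\<^sup>+u. ennreal (norm (F p u)) \<partial>M \<partial>?L)"
    using nn_integral_fst[OF nn] by simp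
  also have "\<dots> = (\<integral>\<^sup>+t1. \<integral>\<^sup>+t2. \<integral>\<^sup>+u. ennreal (norm (F (t1, t2) u)) \<partial>M \<partial>lborel \<partial>lborel)"
    using lborel.nn_integral_fst[OF nn'] by simp
  also have "\<dots> < \<infinity>"
    using fin by (simp add: F_norm)
  finally have F_int: "integrable (?L \<Otimes>\<^sub>M M) (case_prod F)"
    by (intro integrableI_bounded F_meas)
  have F_mean: "(LINT u|M. F p u) = G p" for p
    unfolding F_def G_def autocorrelation_def by (simp flip: of_real_mult)
  show "integrable ?L G"
    using P.integrable_fst[OF F_int] by (simp add: F_mean)
  have square: "complex_of_real ((cmod (LINT t|lborel. w t * x t u))\<^sup>2) = 
      (LINT t1|lborel. LINT t2|lborel. F (t1, t2) u)" for u
  proof -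
    \<comment> \<open>Constant factors leave a Bochner integral even if the path is not integrable, because an
      integral that does not exist has the value 0.\<close>
    have "F (t1, t2) u = (w t1 * x t1 u) * cnj (w t2 * x t2 u)" for t1 t2
      by (simp add: F_def)
    then have "(LINT t1|lborel. LINT t2|lborel. F (t1, t2) u) =
        (LINT t1|lborel. (w t1 * x t1 u) * cnj (LINT t2|lborel. w t2 * x t2 u))"
      by (simp only: integral_mult_right_zero Bochner_Integration.integral_cnj)
    also have "\<dots> = (LINT t1|lborel. w t1 * x t1 u) * cnj (LINT t2|lborel. w t2 * x t2 u)"
      by (simp only: integral_mult_left_zero)
    finally show ?thesis
      by (simp only: complex_norm_square)
  qed
  \<comment> \<open>The iterated and the planar integral of a sample agree only for almost every sample, so both
    must be shown measurable before their means can be equated.\<close>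
  have sq_meas: "(\<lambda>u. LINT t1|lborel. LINT t2|lborel. F (t1, t2) u) \<in> borel_measurable M"
  proof -
    have [measurable]: "(\<lambda>q. F (snd (fst q), snd q) (fst (fst q))) \<in>
        borel_measurable ((M \<Otimes>\<^sub>M lborel) \<Otimes>\<^sub>M lborel)"
      using measurable_compose[OF _ F_meas, 
          of "\<lambda>q. ((snd (fst q), snd q), fst (fst q))" "(M \<Otimes>\<^sub>M lborel) \<Otimes>\<^sub>M lborel"]
      by simp
    have 1: "(\<lambda>q. LINT t2|lborel. F (snd q, t2) (fst q)) \<in> borel_measurable (M \<Otimes>\<^sub>M lborel)"
      by (rule lborel.borel_measurable_lebesgue_integral) (simp add: split_beta)
    show ?thesis
      by (rule lborel.borel_measurable_lebesgue_integral) (use 1 in \<open>simp add: split_beta\<close>)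
  qed
  have slice: "(\<lambda>u. LINT p|?L. F p u) \<in> borel_measurable M"
    using P.integrable_snd[OF F_int] by auto
  have "complex_of_real (LINT u|M. (cmod (LINT t|lborel. w t * x t u))\<^sup>2) =
      (LINT u|M. LINT t1|lborel. LINT t2|lborel. F (t1, t2) u)"
    by (simp only: square flip: integral_complex_of_real)
  also have "\<dots> = (LINT u|M. LINT p|?L. F p u)"
  proof (rule integral_cong_AE[OF sq_meas slice])
    show "AE u in M. (LINT t1|lborel. LINT t2|lborel. F (t1, t2) u) = (LINT p|?L. F p u)"
      using P.AE_integrable_snd[OF F_int] by eventually_elim (rule lborel_pair.integral_fst')
  qed
  also have "\<dots> = (LINT p|?L. LINT u|M. F p u)"
    by (rule P.Fubini_integral[OF F_int])
  finally show "complex_of_real (LINT u|M. (cmod (LINT t|lborel. w t * x t u))\<^sup>2) = (LINT p|?L. G p)"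
    by (simp add: F_mean)
qed

section \<open>Passing to lag coordinates\<close>

text \<open>
  The shear \<open>(t, s) \<mapsto> (t, t - s)\<close> preserves planar Lebesgue measure because, for each fixed
  \<open>t\<close>, it is a reflection of the line. The same substitution applied to \<open>norm \<circ> G\<close> provides the
  absolute integrability needed to exchange the order of integration afterwards.
\<close>

lemma integral_lag_coordinates:
  fixes G :: "real \<times> real \<Rightarrow> complex"
  assumes G: "integrable (lborel \<Otimes>\<^sub>M lborel) G"
  shows "(LINT p|(lborel \<Otimes>\<^sub>M lborel). G p) = (LINT \<tau>|lborel. LINT t|lborel. G (t, t - \<tau>))"
proof -
  let ?L = "lborel \<Otimes>\<^sub>M lborel :: (real \<times> real) measure"
  have Gm[measurable]: "G \<in> borel_measurable ?L"
    using G by auto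
  define H where "H t \<tau> = G (t, t - \<tau>)" for t \<tau>
  have H[measurable]: "case_prod H \<in> borel_measurable ?L"
    unfolding H_def split_beta by measurable
  have slice[measurable]: "(\<lambda>s. G (t, s)) \<in> borel_measurable borel" for t
    using measurable_compose[OF measurable_Pair1' Gm, of t] by simp
  have "(\<integral>\<^sup>+p. ennreal (norm (case_prod H p)) \<partial>?L) = 
      (\<integral>\<^sup>+t. \<integral>\<^sup>+\<tau>. ennreal (norm (H t \<tau>)) \<partial>lborel \<partial>lborel)"
    using lborel.nn_integral_fst[of "\<lambda>p. ennreal (norm (case_prod H p))" lborel] by simp
  also have "\<dots> = (\<integral>\<^sup>+t. \<integral>\<^sup>+s. ennreal (norm (G (t, s))) \<partial>lborel \<partial>lborel)"
    using nn_integral_real_affine[of "\<lambda>s. ennreal (norm (G (_, s)))" "-1"] by (simp add: H_def)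
  also have "\<dots> = (\<integral>\<^sup>+p. ennreal (norm (G p)) \<partial>?L)"
    by (rule lborel.nn_integral_fst) simp
  also have "\<dots> < \<infinity>"
    using G by (simp add: integrable_iff_bounded)
  finally have H_int: "integrable ?L (case_prod H)"
    by (intro integrableI_bounded H)
  have "(LINT p|?L. G p) = (LINT t|lborel. LINT s|lborel. G (t, s))"
    by (rule lborel_pair.integral_fst'[OF G, symmetric])
  also have "\<dots> = (LINT t|lborel. LINT \<tau>|lborel. H t \<tau>)"
    using lborel_integral_real_affine[of "-1" "\<lambda>s. G (_, s)"] by (simp add: H_def)
  also have "\<dots> = (LINT \<tau>|lborel. LINT t|lborel. H t \<tau>)"
    by (rule lborel_pair.Fubini_integral[OF H_int, symmetric])
  finally show ?thesis
    by (simp add: H_def)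
qed

text \<open>
  The normalisation is that of the biased autocorrelation estimate: the divisor is \<open>2T\<close> at every
  lag, although for \<open>\<bar>\<tau>\<bar> \<le> 2T\<close> the pairs inside the window fill only the length
  \<open>2T - \<bar>\<tau>\<bar>\<close>. This is the form in which the periodogram produces it.
\<close>

definition windowed_autocorrelation ::
    "'a measure \<Rightarrow> (real \<Rightarrow> 'a \<Rightarrow> real) \<Rightarrow> real \<Rightarrow> real \<Rightarrow> real" where
  "windowed_autocorrelation M x T \<tau> =
     1 / (2 * T) * (LINT t|lborel. indicator {-T..T} t * indicator {-T..T} (t - \<tau>) *
       autocorrelation M x t (t - \<tau>))"

lemma borel_measurable_autocorrelation_lag:
  assumes "prob_space M"
    and process: "(\<lambda>(t, u). x t u) \<in> borel_measurable (borel \<Otimes>\<^sub>M M)"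
  shows "(\<lambda>p. autocorrelation M x (snd p) (snd p - fst p)) \<in> borel_measurable (borel \<Otimes>\<^sub>M borel)"
    and "(\<lambda>t. autocorrelation M x t (t - \<tau>)) \<in> borel_measurable borel"
proof -
  have R: "(\<lambda>p. autocorrelation M x (fst p) (snd p)) \<in> borel_measurable (borel \<Otimes>\<^sub>M borel)"
    using borel_measurable_autocorrelation[OF assms] by (simp cong: measurable_cong_sets)
  show "(\<lambda>p. autocorrelation M x (snd p) (snd p - fst p)) \<in> borel_measurable (borel \<Otimes>\<^sub>M borel)"
    using measurable_compose[OF _ R, of "\<lambda>p. (snd p, snd p - fst p)" "borel \<Otimes>\<^sub>M borel"] by simp
  show "(\<lambda>t. autocorrelation M x t (t - \<tau>)) \<in> borel_measurable borel"
    using measurable_compose[OF _ R, of "\<lambda>t. (t, t - \<tau>)" "borel"] by simp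
qed

lemma borel_measurable_windowed_autocorrelation:
  assumes "prob_space M"
    and process: "(\<lambda>(t, u). x t u) \<in> borel_measurable (borel \<Otimes>\<^sub>M M)"
  shows "windowed_autocorrelation M x T \<in> borel_measurable borel"
proof -
  note [measurable] = borel_measurable_autocorrelation_lag(1)[OF assms]
  have "case_prod (\<lambda>\<tau> t. indicator {-T..T} t * indicator {-T..T} (t - \<tau>) *
       autocorrelation M x t (t - \<tau>)) \<in> borel_measurable (borel \<Otimes>\<^sub>M lborel)"
    unfolding split_beta by measurable
  from lborel.borel_measurable_lebesgue_integral[OF this]
  show ?thesis
    unfolding windowed_autocorrelation_def[abs_def] by measurable
qed

text \<open>
  The product \<open>exp (- \<i> \<omega> t) cnj (exp (- \<i> \<omega> (t - \<tau>)))\<close> equals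
  \<open>exp (- \<i> \<omega> \<tau>)\<close>, so at a fixed lag the phase leaves the integral over \<open>t\<close>.
\<close>

lemma mean_periodogram_eq_windowed:
  assumes "prob_space M"
    and process: "(\<lambda>(t, u). x t u) \<in> borel_measurable (borel \<Otimes>\<^sub>M M)"
    and local_int: "(\<integral>\<^sup>+t2\<in>{-T..T}. (\<integral>\<^sup>+t1\<in>{-T..T}.
         (\<integral>\<^sup>+u. ennreal \<bar>x t1 u * x t2 u\<bar> \<partial>M) \<partial>lebesgue) \<partial>lebesgue) < \<infinity>"
  shows "complex_of_real (mean_periodogram M x T \<omega>) =
    fourier_transform (windowed_autocorrelation M x T) \<omega>"
proof -
  interpret prob_space M by fact
  define w where "w t = indicator {-T..T} t * exp (- \<i> * complex_of_real (\<omega> * t))" for t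
  have w[measurable]: "w \<in> borel_measurable borel"
    unfolding w_def by measurable
  have w_norm: "cmod (w t) = indicator {-T..T} t" for t
    by (simp add: w_def norm_mult indicator_def)
  have w_lag: "w t * cnj (w (t - \<tau>)) = 
      complex_of_real (indicator {-T..T} t * indicator {-T..T} (t - \<tau>)) *
      exp (- \<i> * complex_of_real (\<omega> * \<tau>))" for t \<tau>
    by (auto simp: w_def indicator_def exp_cnj algebra_simps simp flip: exp_add)
  have "(\<integral>\<^sup>+t1. \<integral>\<^sup>+t2. \<integral>\<^sup>+u. ennreal (cmod (w t1) * cmod (w t2) * \<bar>x t1 u * x t2 u\<bar>)
       \<partial>M \<partial>lborel \<partial>lborel) =
      (\<integral>\<^sup>+t2\<in>{-T..T}. (\<integral>\<^sup>+t1\<in>{-T..T}.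
         (\<integral>\<^sup>+u. ennreal \<bar>x t1 u * x t2 u\<bar> \<partial>M) \<partial>lebesgue) \<partial>lebesgue)"
  proof -
    have inner: "(\<integral>\<^sup>+u. ennreal (cmod (w t1) * cmod (w t2) * \<bar>x t1 u * x t2 u\<bar>) \<partial>M) =
        (\<integral>\<^sup>+u. ennreal \<bar>x t2 u * x t1 u\<bar> \<partial>M) * indicator {-T..T} t2 * indicator {-T..T} t1" for t1 t2
      by (cases "t1 \<in> {-T..T}"; cases "t2 \<in> {-T..T}") (simp_all add: w_norm mult.commute)
    have "(\<integral>\<^sup>+t2. (\<integral>\<^sup>+u. ennreal \<bar>x t2 u * x t1 u\<bar> \<partial>M) * indicator {-T..T} t2 *
          indicator {-T..T} t1 \<partial>lborel) =
        (\<integral>\<^sup>+t2\<in>{-T..T}. (\<integral>\<^sup>+u. ennreal \<bar>x t2 u * x t1 u\<bar> \<partial>M) \<partial>lborel) * indicator {-T..T} t1" for t1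
      by (cases "t1 \<in> {-T..T}") simp_all
    then show ?thesis
      unfolding nn_integral_completion inner by simp
  qed
  with local_int have fin: "(\<integral>\<^sup>+t1. \<integral>\<^sup>+t2. \<integral>\<^sup>+u. ennreal (cmod (w t1) * cmod (w t2) *
      \<bar>x t1 u * x t2 u\<bar>) \<partial>M \<partial>lborel \<partial>lborel) < \<infinity>"
    by simp
  note sm = second_moment_weighted_integral[OF assms(1) process w fin]
  have trunc: "truncated_fourier x T \<omega> u = (LINT t|lborel. w t * x t u)" if "u \<in> space M" for u
  proof -
    have "(\<lambda>t. x t u) \<in> borel_measurable borel"
      using measurable_compose[OF measurable_Pair2'[OF that] process] by simp
    then have "(\<lambda>t. w t * x t u) \<in> borel_measurable lborel"
      by simp
    from integral_completion[OF this] show ?thesis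
      unfolding truncated_fourier_def set_lebesgue_integral_def
      by (simp add: w_def indicator_scaleR_eq_if ac_simps scaleR_conv_of_real of_real_indicator)
  qed
  have "complex_of_real (mean_periodogram M x T \<omega>) =
      complex_of_real (LINT u|M. (cmod (LINT t|lborel. w t * x t u))\<^sup>2) / (2 * T)"
    by (simp add: mean_periodogram_def trunc cong: Bochner_Integration.integral_cong)
  also have "\<dots> = (LINT \<tau>|lborel. LINT t|lborel. 
      w t * cnj (w (t - \<tau>)) * autocorrelation M x t (t - \<tau>)) / (2 * T)"
    using integral_lag_coordinates[OF sm(1)] sm(2) by simp
  also have "\<dots> = (LINT \<tau>|lborel. complex_of_real (windowed_autocorrelation M x T \<tau>) *
      exp (- \<i> * complex_of_real (\<omega> * \<tau>)))"
  proof -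
    have "(LINT t|lborel. w t * cnj (w (t - \<tau>)) * autocorrelation M x t (t - \<tau>)) / (2 * T) =
      complex_of_real (windowed_autocorrelation M x T \<tau>) * exp (- \<i> * complex_of_real (\<omega> * \<tau>))" for \<tau>
    proof -
      have "(LINT t|lborel. w t * cnj (w (t - \<tau>)) * autocorrelation M x t (t - \<tau>)) =
        (LINT t|lborel. complex_of_real (indicator {-T..T} t * indicator {-T..T} (t - \<tau>) *
          autocorrelation M x t (t - \<tau>)) * exp (- \<i> * complex_of_real (\<omega> * \<tau>)))"
        unfolding w_lag by (simp add: ac_simps)
      also have "\<dots> = complex_of_real (LINT t|lborel. indicator {-T..T} t * indicator {-T..T} (t - \<tau>) *
          autocorrelation M x t (t - \<tau>)) * exp (- \<i> * complex_of_real (\<omega> * \<tau>))"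
        by (simp only: integral_mult_left_zero integral_complex_of_real)
      finally show ?thesis
        by (simp add: windowed_autocorrelation_def)
    qed
    then show ?thesis
      by (simp flip: integral_divide_zero)
  qed
  also have "\<dots> = fourier_transform (windowed_autocorrelation M x T) \<omega>"
    unfolding fourier_transform_def
    using borel_measurable_windowed_autocorrelation[OF assms(1,2), of T]
    by (intro integral_completion[symmetric]) simp
  finally show ?thesis .
qed

section \<open>Windowed and plain time averages\<close>

lemma integral_indicator_mult_le:
  fixes f :: "real \<Rightarrow> real"
  assumes "\<And>t. \<bar>f t\<bar> \<le> C * indicator {a..b} t" "a \<le> b"
  shows "\<bar>LINT t|lborel. f t\<bar> \<le> C * (b - a)"
proof (cases "integrable lborel f")
  case True
  have "\<bar>LINT t|lborel. f t\<bar> \<le> (LINT t|lborel. C * indicator {a..b} t)"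
    by (intro integral_abs_bound_integral True integrable_mult_right integrable_real_indicator)
       (use assms(1) in \<open>simp_all add: emeasure_lborel_Icc_eq\<close>)
  then show ?thesis
    using assms(2) by simp
next
  case False
  have "0 \<le> C"
    using assms(1)[of a] assms(2) by simp
  then show ?thesis
    using False assms(2) by (simp add: not_integrable_integral_eq)
qed

text \<open>
  This is the domination: the integrand is at most \<open>C\<close> and lives on a window of length
  \<open>2T\<close>, which cancels the normalisation.
\<close>

lemma abs_windowed_autocorrelation_le:
  assumes R: "\<And>t. \<bar>autocorrelation M x t (t - \<tau>)\<bar> \<le> C" and T: "0 < T"
  shows "\<bar>windowed_autocorrelation M x T \<tau>\<bar> \<le> C"
proof -
  have "0 \<le> C"
    using R[of 0] by linarith
  have "\<bar>LINT t|lborel. indicator {-T..T} t * indicator {-T..T} (t - \<tau>) *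
       autocorrelation M x t (t - \<tau>)\<bar> \<le> C * (T - - T)"
    by (rule integral_indicator_mult_le) (use R \<open>0 \<le> C\<close> T in \<open>auto simp: indicator_def\<close>)
  then show ?thesis
    using T by (simp add: windowed_autocorrelation_def abs_mult field_simps)
qed

text \<open>
  A lag \<open>\<tau>\<close> carries a time \<open>t\<close> out of \<open>[-T, T]\<close> only if \<open>t\<close> is within
  \<open>\<bar>\<tau>\<bar>\<close> of the end towards which it moves: the left end for positive \<open>\<tau>\<close>, the right end
  for negative \<open>\<tau>\<close>.
\<close>

lemma abs_windowed_minus_time_average_le:
  assumes "prob_space M"
    and process: "(\<lambda>(t, u). x t u) \<in> borel_measurable (borel \<Otimes>\<^sub>M M)"
    and R: "\<And>t. \<bar>autocorrelation M x t (t - \<tau>)\<bar> \<le> C" and T: "0 < T"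
  shows "\<bar>windowed_autocorrelation M x T \<tau> - time_average_autocorrelation M x T \<tau>\<bar> \<le>
    C * \<bar>\<tau>\<bar> / (2 * T)"
proof -
  have "0 \<le> C"
    using R[of 0] by linarith
  note [measurable] = borel_measurable_autocorrelation_lag(2)[OF assms(1,2), of \<tau>]
  let ?f = "\<lambda>t. indicator {-T..T} t * autocorrelation M x t (t - \<tau>)"
  let ?g = "\<lambda>t. indicator {-T..T} t * indicator {-T..T} (t - \<tau>) * autocorrelation M x t (t - \<tau>)"
  have dom: "integrable lborel (\<lambda>t. C * indicator {-T..T} t)"
    by (intro integrable_mult_right integrable_real_indicator) (simp_all add: emeasure_lborel_Icc_eq)
  have f: "integrable lborel ?f"
    by (rule Bochner_Integration.integrable_bound[OF dom])
       (use R \<open>0 \<le> C\<close> in \<open>auto simp: indicator_def\<close>)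
  have g: "integrable lborel ?g"
    by (rule Bochner_Integration.integrable_bound[OF dom])
       (use R \<open>0 \<le> C\<close> in \<open>auto simp: indicator_def\<close>)
  have avg: "time_average_autocorrelation M x T \<tau> = 1 / (2 * T) * (LINT t|lborel. ?f t)"
    unfolding time_average_autocorrelation_def set_lebesgue_integral_def
    using integral_completion[of ?f lborel] by simp
  have "\<bar>LINT t|lborel. ?g t - ?f t\<bar> \<le> C * \<bar>\<tau>\<bar>"
  proof (cases "0 \<le> \<tau>")
    case True
    have "\<bar>LINT t|lborel. ?g t - ?f t\<bar> \<le> C * ((-T + \<tau>) - (-T))"
      by (rule integral_indicator_mult_le) (use R \<open>0 \<le> C\<close> True in \<open>auto simp: indicator_def\<close>)
    then show ?thesis using True by simp
  next
    case False
    have "\<bar>LINT t|lborel. ?g t - ?f t\<bar> \<le> C * (T - (T + \<tau>))"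
      by (rule integral_indicator_mult_le) (use R \<open>0 \<le> C\<close> False in \<open>auto simp: indicator_def\<close>)
    then show ?thesis using False by simp
  qed
  moreover have "windowed_autocorrelation M x T \<tau> - time_average_autocorrelation M x T \<tau> =
      1 / (2 * T) * (LINT t|lborel. ?g t - ?f t)"
    unfolding avg windowed_autocorrelation_def Bochner_Integration.integral_diff[OF g f]
    by (simp add: right_diff_distrib)
  ultimately show ?thesis
    using T by (simp only: abs_mult) (simp add: divide_right_mono)
qed

lemma windowed_autocorrelation_tendsto:
  assumes "prob_space M"
    and process: "(\<lambda>(t, u). x t u) \<in> borel_measurable (borel \<Otimes>\<^sub>M M)"
    and R: "\<And>t. \<bar>autocorrelation M x t (t - \<tau>)\<bar> \<le> C"
    and L: "((\<lambda>T. time_average_autocorrelation M x T \<tau>) \<longlongrightarrow> L) at_top"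
  shows "((\<lambda>T. windowed_autocorrelation M x T \<tau>) \<longlongrightarrow> L) at_top"
proof -
  have "((\<lambda>T. C * \<bar>\<tau>\<bar> / (2 * T)) \<longlongrightarrow> 0) at_top"
    by real_asymp
  then have "((\<lambda>T. windowed_autocorrelation M x T \<tau> - time_average_autocorrelation M x T \<tau>) \<longlongrightarrow> 0) at_top"
    by (rule Lim_null_comparison[rotated])
       (use abs_windowed_minus_time_average_le[OF assms(1-3)] in
        \<open>auto intro: eventually_mono[OF eventually_gt_at_top[of 0]]\<close>)
  from tendsto_add[OF this L] show ?thesis
    by simp
qed

section \<open>The limit of the mean periodogram\<close>

text \<open>
  The averaged autocorrelation is a limit only almost everywhere and has an arbitrary value elsewhere,
  so its measurability rests on the completeness of Lebesgue measure.
\<close>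

lemma borel_measurable_completion_AE:
  fixes f g :: "'a \<Rightarrow> 'b::topological_space"
  assumes g: "g \<in> borel_measurable (completion M)" and eq: "AE x in completion M. f x = g x"
  shows "f \<in> borel_measurable (completion M)"
proof (rule measurableI)
  fix A :: "'b set" assume "A \<in> sets borel"
  then have "g -` A \<inter> space (completion M) \<in> sets (completion M)"
    by (rule measurable_sets[OF g])
  then show "f -` A \<inter> space (completion M) \<in> sets (completion M)"
    by (rule completion.in_sets_AE[rotated]) (use eq in \<open>auto elim: eventually_mono\<close>)
qed simp

theorem theorem1:
  fixes M :: "'a measure" and x :: "real \<Rightarrow> 'a \<Rightarrow> real"
  assumes "prob_space M"
    and process: "(\<lambda>(t, u). x t u) \<in> borel_measurable (borel \<Otimes>\<^sub>M M)"
    and local_int: "\<And>T::real.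
      (\<integral>\<^sup>+t2\<in>{-T..T}. (\<integral>\<^sup>+t1\<in>{-T..T}.
         (\<integral>\<^sup>+u. ennreal \<bar>x t1 u * x t2 u\<bar> \<partial>M) \<partial>lebesgue) \<partial>lebesgue) < \<infinity>"
    and max_meas: "max_abs_autocorrelation M x \<in> borel_measurable lebesgue"
    and max_int: "(\<integral>\<^sup>+\<tau>. max_abs_autocorrelation M x \<tau> \<partial>lebesgue) < \<infinity>"
    and avg_exists: "AE \<tau> in lebesgue. \<exists>L.
      ((\<lambda>T. time_average_autocorrelation M x T \<tau>) \<longlongrightarrow> L) at_top"
  shows "\<forall>\<omega>::real.
      ((\<lambda>T. mean_periodogram M x T \<omega>) \<longlongrightarrow> power_spectral_density M x \<omega>) at_top \<and>
      complex_of_real (power_spectral_density M x \<omega>) =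
        fourier_transform (averaged_autocorrelation M x) \<omega>"
proof
  fix \<omega> :: real
  let ?g = "windowed_autocorrelation M x" and ?R = "averaged_autocorrelation M x"
  let ?e = "\<lambda>\<tau>. exp (- \<i> * complex_of_real (\<omega> * \<tau>))"
  define m where "m \<tau> = enn2real (max_abs_autocorrelation M x \<tau>)" for \<tau>
  note max_meas[measurable]
  have finite: "AE \<tau> in lebesgue. max_abs_autocorrelation M x \<tau> \<noteq> \<infinity>"
    using max_int by (intro nn_integral_PInf_AE max_meas) auto
  have bound: "\<bar>autocorrelation M x t (t - \<tau>)\<bar> \<le> m \<tau>"
    if "max_abs_autocorrelation M x \<tau> \<noteq> \<infinity>" for \<tau> t
  proof -
    have "ennreal \<bar>autocorrelation M x t (t - \<tau>)\<bar> \<le> max_abs_autocorrelation M x \<tau>"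
      unfolding max_abs_autocorrelation_def by (rule SUP_upper) simp
    also have "\<dots> = ennreal (m \<tau>)"
      using that by (simp add: m_def less_top)
    finally show ?thesis
      by (simp add: m_def)
  qed
  have m_int: "integrable lebesgue m"
  proof (rule integrableI_nonneg)
    show "m \<in> borel_measurable lebesgue"
      unfolding m_def[abs_def] by measurable
    have "(\<integral>\<^sup>+\<tau>. ennreal (m \<tau>) \<partial>lebesgue) = (\<integral>\<^sup>+\<tau>. max_abs_autocorrelation M x \<tau> \<partial>lebesgue)"
      using finite by (intro nn_integral_cong_AE) (auto elim!: eventually_mono simp: m_def less_top)
    then show "(\<integral>\<^sup>+\<tau>. ennreal (m \<tau>) \<partial>lebesgue) < \<infinity>"
      using max_int by simp
  qed (simp add: m_def)
  have lim: "AE \<tau> in lebesgue. ((\<lambda>T. ?g T \<tau>) \<longlongrightarrow> ?R \<tau>) at_top"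
    using avg_exists finite
  proof eventually_elim
    case (elim \<tau>)
    then obtain L where L: "((\<lambda>T. time_average_autocorrelation M x T \<tau>) \<longlongrightarrow> L) at_top"
      by auto
    then have "?R \<tau> = L"
      unfolding averaged_autocorrelation_def by (intro tendsto_Lim) simp_all
    with windowed_autocorrelation_tendsto[OF assms(1) process bound[OF elim(2)] L] show ?case
      by simp
  qed
  have g_meas[measurable]: "?g T \<in> borel_measurable lebesgue" for T
    using borel_measurable_windowed_autocorrelation[OF assms(1) process, of T]
    by (intro measurable_completion) simp
  have e_meas[measurable]: "?e \<in> borel_measurable lebesgue"
    by (intro measurable_completion) simp
  have R_meas[measurable]: "?R \<in> borel_measurable lebesgue"
  proof (rule borel_measurable_completion_AE)
    \<comment> \<open>Restricting \<open>T\<close> to the naturals makes the limit one of a sequence of measurable functions.\<close>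
    show "(\<lambda>\<tau>. lim (\<lambda>n::nat. ?g (real n) \<tau>)) \<in> borel_measurable lebesgue"
      by measurable
    show "AE \<tau> in lebesgue. ?R \<tau> = lim (\<lambda>n::nat. ?g (real n) \<tau>)"
      using lim
    proof eventually_elim
      case (elim \<tau>)
      from limI[OF filterlim_compose[OF this filterlim_real_sequentially]] show ?case
        by simp
    qed
  qed
  have "((\<lambda>T. fourier_transform (?g T) \<omega>) \<longlongrightarrow> fourier_transform ?R \<omega>) at_top"
    unfolding fourier_transform_def
  proof (rule integral_dominated_convergence_at_top[where w = m])
    show "AE \<tau> in lebesgue. ((\<lambda>T. complex_of_real (?g T \<tau>) * ?e \<tau>) \<longlongrightarrow>
        complex_of_real (?R \<tau>) * ?e \<tau>) at_top"
      using lim by eventually_elim (intro tendsto_intros)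
    show "\<forall>\<^sub>F T in at_top. AE \<tau> in lebesgue. cmod (complex_of_real (?g T \<tau>) * ?e \<tau>) \<le> m \<tau>"
      using eventually_gt_at_top[of 0]
    proof eventually_elim
      case (elim T)
      from finite show ?case
        by eventually_elim
          (use abs_windowed_autocorrelation_le[OF bound elim] in \<open>simp add: norm_mult\<close>)
    qed
  qed (measurable, rule m_int)
  then have conv: "((\<lambda>T. complex_of_real (mean_periodogram M x T \<omega>)) \<longlongrightarrow> fourier_transform ?R \<omega>) at_top"
    by (simp add: mean_periodogram_eq_windowed[OF assms(1) process local_int])
  \<comment> \<open>Real numbers converge to a complex limit only if the limit is real.\<close>
  from tendsto_Re[OF conv] have Re: "((\<lambda>T. mean_periodogram M x T \<omega>) \<longlongrightarrow> Re (fourier_transform ?R \<omega>)) at_top"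
    by simp
  have Im: "Im (fourier_transform ?R \<omega>) = 0"
    using tendsto_Im[OF conv] by (simp add: tendsto_const_iff)
  have "power_spectral_density M x \<omega> = Re (fourier_transform ?R \<omega>)"
    unfolding power_spectral_density_def by (intro tendsto_Lim Re) simp
  with Re Im show "((\<lambda>T. mean_periodogram M x T \<omega>) \<longlongrightarrow> power_spectral_density M x \<omega>) at_top \<and>
      complex_of_real (power_spectral_density M x \<omega>) = fourier_transform ?R \<omega>"
    by (simp add: complex_eq_iff)
qed

end
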